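(* Let $\ell\ge 1$, let $n=2\ell+2$, and let $\mathbf{F}$ be a field. The degree $2\ell$ part $\mathrm{QH}^{2\ell}(\mathrm{Gr}(2,n);\mathbf{F})$ is $(\ell+1)$-dimensional over $\mathbf{F}$, with basis $v_0,\dots,v_\ell$, where $v_j=\sigma_{D_j}$ and $D_j$ is the Young diagram with $2\ell-j$ boxes in the first row and $j$ boxes in the second row. There is a degree zero element $A\in\mathrm{QH}^0(\mathrm{Gr}(2,n);\mathbf{F})$ such that multiplication by $A$ on $\mathrm{QH}^{2\ell}(\mathrm{Gr}(2,n);\mathbf{F})$ has, with respect to this basis, the $(\ell+1)\times(\ell+1)$ tridiagonal matrix $M$ whose first and last diagonal entries are $+1$, whose other diagonal entries are $0$, whose entries immediately above and below the diagonal are all $-1$, and whose remaining entries are $0$. If $\pi(y)=\det(M-yI)$ is the characteristic polynomial of this matrix, then $$x^{\ell+1}\,\pi(-x-x^{-1})=(x+1)(x^{n-1}+\dots+x+1).$$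
   Context: $\mathrm{Gr}(k,n)$ is the Grassmannian of complex $k$-planes in $\mathbf{C}^n$. $H^*(\mathrm{Gr}(k,n);\mathbf{Z})$ is the free graded $\mathbf{Z}$-module on Schubert classes $\sigma_D$, where $D$ runs over Young diagrams fitting in a rectangle with $k$ rows and $n-k$ columns. Complex degrees are used: $\deg\sigma_D$ is the number of boxes of $D$. Let $q$ be a formal variable of degree $n$. The module $H^*(\mathrm{Gr}(k,n);\mathbf{Z})\otimes\mathbf{Z}[q]$ carries the (small) quantum cup product $\ast$, a graded, commutative, associative $\mathbf{Z}[q]$-bilinear deformation of the cup product by three-point genus-zero Gromov–Witten invariants, with unit $1=\sigma_\emptyset$. For a field $\mathbf{F}$, $$\mathrm{QH}^*(\mathrm{Gr}(k,n);\mathbf{F}):=(H^*(\mathrm{Gr}(k,n);\mathbf{Z})\otimes\mathbf{Z}[q])\otimes_{\mathbf{Z}[q]}\mathbf{F}[q^{-1},q],$$ and $\mathrm{QH}^d$ is its degree $d$ part. The product is determined by the quantum Pieri rule $x_j\ast\sigma_D=\sum_{D'}\sigma_{D'}+\sum_{D''}q\,\sigma_{D''}$, where $x_j$ ($1\le j\le k$) is the class of the diagram consisting of a single column of $j$ boxes. The first sum is over diagrams $D'$ (in the rectangle) obtained from $D$ by adding $j$ boxes, at most one in each row. The second sum occurs only if the top row of $D$ is full (has $n-k$ boxes), and is over all diagrams $D''$ obtained from $D$ by removing $n-j$ boxes consisting of the entire top row and at most one box in each of the other rows, and then shifting the result up by one row. *)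

theory Defs
  imports
    "HOL-Library.Poly_Mapping"
    "HOL-Computational_Algebra.Polynomial"
    "Jordan_Normal_Form.Determinant"
begin

section \<open>Schubert classes\<close>

text \<open>
  A Young diagram in the rectangle with \<open>k\<close> rows and \<open>n - k\<close> columns is the list of its \<open>k\<close> row
  lengths from top to bottom, with empty rows recorded as \<open>0\<close>. Its number of boxes is \<open>sum_list D\<close>.
\<close>

definition diagrams :: "nat \<Rightarrow> nat \<Rightarrow> nat list set" where
  "diagrams k n = {D. length D = k \<and> sorted_wrt (\<ge>) D \<and> (\<forall>r\<in>set D. r \<le> n - k)}"

definition empty_diagram :: "nat \<Rightarrow> nat list" where
  "empty_diagram k = replicate k 0"

definition column :: "nat \<Rightarrow> nat \<Rightarrow> nat list" where
  "column k j = replicate j 1 @ replicate (k - j) 0"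

text \<open>
  An element of \<open>H\<^sup>*(Gr(k,n); \<int>) \<otimes> R\<close> is a finitely supported family of coefficients in \<open>R\<close>, indexed
  by diagrams; membership in the module means that the support lies in \<open>diagrams k n\<close>.
\<close>

type_synonym 'r schubert_comb = "nat list \<Rightarrow>\<^sub>0 'r"

definition \<sigma> :: "nat list \<Rightarrow> 'r::zero_neq_one schubert_comb" where
  "\<sigma> D = Poly_Mapping.single D 1"

definition scale :: "'r::semiring_0 \<Rightarrow> 'r schubert_comb \<Rightarrow> 'r schubert_comb" where
  "scale r u = Poly_Mapping.map ((*) r) u"


section \<open>The quantum product over \<open>\<int>[q]\<close>\<close>

text \<open>
  The ring \<open>\<int>[q]\<close> is \<^typ>\<open>int poly\<close>, with \<open>q = [:0, 1:]\<close>. A \<open>\<int>[q]\<close>-bilinear product on the free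
  module on the Schubert classes is the same as a table \<open>c\<close> whose entry \<open>c D E\<close> is the
  product of \<open>\<sigma> D\<close> and \<open>\<sigma> E\<close>. \<open>bilinear_product \<phi> c\<close> is the product obtained from this one by
  extension of scalars along a ring homomorphism \<open>\<phi> : \<int>[q] \<rightarrow> R\<close>.
\<close>

type_synonym product_table = "nat list \<Rightarrow> nat list \<Rightarrow> int poly schubert_comb"

definition bilinear_product ::
    "(int poly \<Rightarrow> 'r::comm_ring_1) \<Rightarrow> product_table
      \<Rightarrow> 'r schubert_comb \<Rightarrow> 'r schubert_comb \<Rightarrow> 'r schubert_comb" where
  "bilinear_product \<phi> c u v =
     (\<Sum>D\<in>Poly_Mapping.keys u. \<Sum>E\<in>Poly_Mapping.keys v.
        scale (Poly_Mapping.lookup u D * Poly_Mapping.lookup v E) (Poly_Mapping.map \<phi> (c D E)))"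

text \<open>The diagrams obtained from \<open>D\<close> by adding \<open>j\<close> boxes, at most one in each row.\<close>

definition pieri_add :: "nat \<Rightarrow> nat \<Rightarrow> nat \<Rightarrow> nat list \<Rightarrow> nat list set" where
  "pieri_add k n j D =
     {D' \<in> diagrams k n. (\<forall>i<k. D ! i \<le> D' ! i \<and> D' ! i \<le> D ! i + 1)
        \<and> sum_list D' = sum_list D + j}"

text \<open>
  The diagrams obtained from a \<open>D\<close> with full top row by removing \<open>n - j\<close> boxes, namely the whole top
  row and at most one box from each other row, and shifting the rest up by one row: the row \<open>i + 1\<close>
  of \<open>D\<close>, possibly shortened by one box, becomes the row \<open>i\<close> of the result.
\<close>

definition pieri_remove :: "nat \<Rightarrow> nat \<Rightarrow> nat \<Rightarrow> nat list \<Rightarrow> nat list set" where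
  "pieri_remove k n j D =
     (if D ! 0 = n - k then
        {D'' \<in> diagrams k n.
           (\<forall>i<k - 1. D'' ! i \<le> D ! (i + 1) \<and> D ! (i + 1) \<le> D'' ! i + 1)
           \<and> D'' ! (k - 1) = 0
           \<and> sum_list D'' + (n - j) = sum_list D}
      else {})"

definition satisfies_pieri :: "nat \<Rightarrow> nat \<Rightarrow> product_table \<Rightarrow> bool" where
  "satisfies_pieri k n c \<longleftrightarrow>
     (\<forall>j\<in>{1..k}. \<forall>D\<in>diagrams k n.
        c (column k j) D =
          (\<Sum>D'\<in>pieri_add k n j D. \<sigma> D') + (\<Sum>D''\<in>pieri_remove k n j D. scale [:0, 1:] (\<sigma> D'')))"

text \<open>
  The quantum product is the graded, commutative, associative, unital \<open>\<int>[q]\<close>-bilinear product that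
  satisfies the quantum Pieri rule; these properties determine it because the classes of the columns
  generate the ring. The degree of \<open>q\<^sup>i \<sigma> D\<close> is \<open>sum_list D + n * i\<close>. Entries of the table
  outside the rectangle are set to zero, so that the table is unique. The intended
  parameters are \<open>0 < k < n\<close>.
\<close>

definition is_quantum_product :: "nat \<Rightarrow> nat \<Rightarrow> product_table \<Rightarrow> bool" where
  "is_quantum_product k n c \<longleftrightarrow>
     (\<forall>D E. Poly_Mapping.keys (c D E) \<subseteq> diagrams k n) \<and>
     (\<forall>D E. D \<notin> diagrams k n \<or> E \<notin> diagrams k n \<longrightarrow> c D E = 0) \<and>
     (\<forall>D\<in>diagrams k n. \<forall>E\<in>diagrams k n. \<forall>G i.
        coeff (Poly_Mapping.lookup (c D E) G) i \<noteq> 0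
          \<longrightarrow> sum_list G + n * i = sum_list D + sum_list E) \<and>
     (\<forall>D\<in>diagrams k n. \<forall>E\<in>diagrams k n. c D E = c E D) \<and>
     (\<forall>D\<in>diagrams k n. \<forall>E\<in>diagrams k n. \<forall>G\<in>diagrams k n.
        bilinear_product id c (c D E) (\<sigma> G) = bilinear_product id c (\<sigma> D) (c E G)) \<and>
     (\<forall>D\<in>diagrams k n. c (empty_diagram k) D = \<sigma> D) \<and>
     satisfies_pieri k n c"

definition quantum_table :: "nat \<Rightarrow> nat \<Rightarrow> product_table" where
  "quantum_table k n = (THE c. is_quantum_product k n c)"


section \<open>Quantum cohomology over a field\<close>

text \<open>The ring of Laurent polynomials, as the monoid algebra of the integers.\<close>

type_synonym 'a laurent = "int \<Rightarrow>\<^sub>0 'a"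

definition lconst :: "'a::zero \<Rightarrow> 'a laurent" where
  "lconst a = Poly_Mapping.single 0 a"

definition lvar :: "'a::zero_neq_one laurent" where
  "lvar = Poly_Mapping.single 1 1"

definition lvar_inv :: "'a::zero_neq_one laurent" where
  "lvar_inv = Poly_Mapping.single (- 1) 1"

definition laurent_of_zpoly :: "int poly \<Rightarrow> 'f::field laurent" where
  "laurent_of_zpoly p = poly (map_poly of_int p) lvar"

definition QH :: "nat \<Rightarrow> nat \<Rightarrow> 'f::field laurent schubert_comb set" where
  "QH k n = {u. Poly_Mapping.keys u \<subseteq> diagrams k n}"

definition QH_deg :: "nat \<Rightarrow> nat \<Rightarrow> int \<Rightarrow> 'f::field laurent schubert_comb set" where
  "QH_deg k n d =
     {u \<in> QH k n. \<forall>D i. Poly_Mapping.lookup (Poly_Mapping.lookup u D) i \<noteq> 0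
                     \<longrightarrow> int (sum_list D) + int n * i = d}"

definition quantum_mult ::
    "nat \<Rightarrow> nat \<Rightarrow> 'f::field laurent schubert_comb
      \<Rightarrow> 'f laurent schubert_comb \<Rightarrow> 'f laurent schubert_comb" where
  "quantum_mult k n = bilinear_product laurent_of_zpoly (quantum_table k n)"

definition fscale :: "'f::field \<Rightarrow> 'f laurent schubert_comb \<Rightarrow> 'f laurent schubert_comb" where
  "fscale a = scale (lconst a)"


section \<open>The middle degree of \<open>Gr(2, 2\<ell> + 2)\<close>\<close>

definition mid_class :: "nat \<Rightarrow> nat \<Rightarrow> 'f::field laurent schubert_comb" where
  "mid_class l j = \<sigma> [2 * l - j, j]"

definition tridiag :: "nat \<Rightarrow> 'f::field mat" where
  "tridiag l = mat (l + 1) (l + 1) (\<lambda>(i, j).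
     if i = j then (if i = 0 \<or> i = l then 1 else 0)
     else if i = j + 1 \<or> j = i + 1 then - 1 else 0)"

text \<open>
  The sign convention is \<open>det (M - y I)\<close>, which differs from that of \<open>char_poly\<close> by the factor
  \<open>(- 1) ^ dim_row M\<close>.
\<close>

definition charpoly_minus :: "'f::field mat \<Rightarrow> 'f poly" where
  "charpoly_minus M =
     det (map_mat (\<lambda>a. [:a:]) M - [:0, 1:] \<cdot>\<^sub>m 1\<^sub>m (dim_row M))"

end

theory Submission
  imports Defs "Jordan_Normal_Form.Char_Poly"
begin

text \<open>
  Let \<open>X\<^sub>1, X\<^sub>2\<close> be the Pieri operators on the free \<open>\<int>[q]\<close>-module on the diagrams of \<open>Gr(2, m + 2)\<close>. They
  commute, and every \<open>\<sigma> D\<close> is obtained from \<open>1 = \<sigma> [0, 0]\<close> by a polynomial \<open>P\<^sub>D(X\<^sub>1, X\<^sub>2)\<close> (a Schur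
  polynomial). Hence an operator commuting with \<open>X\<^sub>1\<close> and \<open>X\<^sub>2\<close> is determined by its value at \<open>1\<close>, so that
  \<open>\<sigma> D * \<sigma> E = P\<^sub>D (\<sigma> E)\<close> is a commutative and associative product. It is the only one satisfying the
  Pieri rule, because the columns generate.

  In terms of the Chern roots \<open>z\<^sub>1, z\<^sub>2\<close>, with \<open>z\<^sub>1\<^sup>n = z\<^sub>2\<^sup>n = - q\<close>, the element \<open>A\<close> is
  \<open>- (z\<^sub>1 / z\<^sub>2 + z\<^sub>2 / z\<^sub>1) = 2 - X\<^sub>1\<^sup>2 X\<^sub>2\<^sup>-\<^sup>1\<close>, which equals \<open>1 - q\<^sup>-\<^sup>1 \<sigma> [2 l, 2]\<close>.
\<close>

section \<open>Linear operators on Schubert combinations\<close>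

lemma lookup_scale [simp]: "Poly_Mapping.lookup (scale r u) D = r * Poly_Mapping.lookup u D"
  by (simp add: scale_def Poly_Mapping.map.rep_eq when_def)

lemma lookup_map: "\<phi> 0 = 0 \<Longrightarrow> Poly_Mapping.lookup (Poly_Mapping.map \<phi> u) D = \<phi> (Poly_Mapping.lookup u D)"
  by (simp add: Poly_Mapping.map.rep_eq when_def)

lemma lookup_sigma: "Poly_Mapping.lookup (\<sigma> D) E = (if D = E then 1 else 0)"
  by (simp add: \<sigma>_def lookup_single when_def)

lemma keys_sigma [simp]: "Poly_Mapping.keys (\<sigma> D) = {D}"
  by (simp add: \<sigma>_def)

lemma map_id [simp]: "Poly_Mapping.map id u = u"
  by (rule poly_mapping_eqI) (simp add: lookup_map)

lemma map_zero: "Poly_Mapping.map \<phi> 0 = 0"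
  by (rule poly_mapping_eqI) (simp add: Poly_Mapping.map.rep_eq)

lemma map_plus:
  assumes "\<phi> 0 = 0" "\<And>p q. \<phi> (p + q) = \<phi> p + \<phi> q"
  shows "Poly_Mapping.map \<phi> (u + v) = Poly_Mapping.map \<phi> u + Poly_Mapping.map \<phi> v"
  by (rule poly_mapping_eqI) (simp add: lookup_map lookup_add assms)

lemma map_scale:
  assumes "\<phi> 0 = 0" "\<And>p q. \<phi> (p * q) = \<phi> p * \<phi> q"
  shows "Poly_Mapping.map \<phi> (scale r u) = scale (\<phi> r) (Poly_Mapping.map \<phi> u)"
  by (rule poly_mapping_eqI) (simp add: lookup_map assms)

lemma map_sigma:
  assumes "\<phi> 0 = 0" "\<phi> 1 = 1"
  shows "Poly_Mapping.map \<phi> (\<sigma> D) = \<sigma> D"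
  by (simp add: \<sigma>_def assms)

interpretation schubert: Modules.module "scale :: 'r::comm_ring_1 \<Rightarrow> 'r schubert_comb \<Rightarrow> 'r schubert_comb"
  by unfold_locales (auto intro!: poly_mapping_eqI simp: lookup_add algebra_simps)

abbreviation linear_op :: "('r::comm_ring_1 schubert_comb \<Rightarrow> 'r schubert_comb) \<Rightarrow> bool" where
  "linear_op \<equiv> module_hom scale scale"

lemma linear_opI:
  "(\<And>u v. T (u + v) = T u + T v) \<Longrightarrow> (\<And>r u. T (scale r u) = scale r (T u)) \<Longrightarrow> linear_op T"
  by unfold_locales auto

lemma schubert_expansion:
  fixes u :: "'r::comm_ring_1 schubert_comb"
  assumes "finite A" "Poly_Mapping.keys u \<subseteq> A"
  shows "u = (\<Sum>D\<in>A. scale (Poly_Mapping.lookup u D) (\<sigma> D))"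
proof (rule poly_mapping_eqI)
  fix E
  have "(\<Sum>D\<in>A. Poly_Mapping.lookup u D * (if D = E then 1 else 0)) = Poly_Mapping.lookup u E"
    using assms by (auto simp: in_keys_iff if_distrib[of "(*) _"] cong: if_cong)
  then show "Poly_Mapping.lookup u E
      = Poly_Mapping.lookup (\<Sum>D\<in>A. scale (Poly_Mapping.lookup u D) (\<sigma> D)) E"
    by (simp add: lookup_sum lookup_sigma)
qed

lemma linear_op_expansion:
  assumes "linear_op T"
  shows "T u = (\<Sum>D\<in>Poly_Mapping.keys u. scale (Poly_Mapping.lookup u D) (T (\<sigma> D)))"
proof -
  interpret module_hom scale scale T by fact
  show ?thesis
    by (subst schubert_expansion[of "Poly_Mapping.keys u" u]) (auto simp: sum scale)
qed

lemma linear_op_eqI: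
  assumes "linear_op S" "linear_op T"
    and "\<And>D. D \<in> Poly_Mapping.keys u \<Longrightarrow> S (\<sigma> D) = T (\<sigma> D)"
  shows "S u = T u"
  unfolding linear_op_expansion[OF assms(1), of u] linear_op_expansion[OF assms(2), of u]
  using assms(3) by (auto intro!: sum.cong)

definition extend :: "(nat list \<Rightarrow> 'r::comm_ring_1 schubert_comb) \<Rightarrow> 'r schubert_comb \<Rightarrow> 'r schubert_comb"
  where "extend f u = (\<Sum>D\<in>Poly_Mapping.keys u. scale (Poly_Mapping.lookup u D) (f D))"

text \<open>Terms outside the support have coefficient zero. A common larger index set is what makes
  sums over different supports comparable in the proof of additivity.\<close>

lemma extend_superset:
  assumes "finite A" "Poly_Mapping.keys u \<subseteq> A"
  shows "extend f u = (\<Sum>D\<in>A. scale (Poly_Mapping.lookup u D) (f D))"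
  unfolding extend_def
  using assms by (intro sum.mono_neutral_left) (auto simp: in_keys_iff)

lemma linear_op_extend: "linear_op (extend f)"
proof (rule linear_opI)
  fix u v :: "'a schubert_comb" and r
  let ?A = "Poly_Mapping.keys u \<union> Poly_Mapping.keys v"
  have "extend f (u + v) = (\<Sum>D\<in>?A. scale (Poly_Mapping.lookup (u + v) D) (f D))"
    by (rule extend_superset) (auto simp: Poly_Mapping.keys_add)
  also have "\<dots> = extend f u + extend f v"
    by (simp add: lookup_add schubert.scale_left_distrib sum.distrib extend_superset[of ?A u]
        extend_superset[of ?A v])
  finally show "extend f (u + v) = extend f u + extend f v" .
  have "extend f (scale r u) = (\<Sum>D\<in>Poly_Mapping.keys u. scale (Poly_Mapping.lookup (scale r u) D) (f D))"
    by (rule extend_superset) (auto simp: in_keys_iff)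
  then show "extend f (scale r u) = scale r (extend f u)"
    by (simp add: extend_def schubert.scale_sum_right)
qed

lemma extend_sigma [simp]: "extend f (\<sigma> D) = f D"
  by (simp add: extend_def lookup_sigma)

lemma keys_sum_subset:
  assumes "\<And>a. a \<in> A \<Longrightarrow> Poly_Mapping.keys (f a) \<subseteq> S"
  shows "Poly_Mapping.keys (\<Sum>a\<in>A. f a) \<subseteq> S"
  using assms
proof (induction A rule: infinite_finite_induct)
  case (insert a A)
  then have "Poly_Mapping.keys (f a) \<union> Poly_Mapping.keys (sum f A) \<subseteq> S" by simp
  then show ?case using insert.hyps Poly_Mapping.keys_add[of "f a" "sum f A"] by auto
qed simp_all

lemma keys_scale_subset: "Poly_Mapping.keys (scale r u) \<subseteq> Poly_Mapping.keys u"
  by (auto simp: in_keys_iff)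

lemma keys_extend:
  assumes "\<And>D. Poly_Mapping.keys (f D) \<subseteq> S"
  shows "Poly_Mapping.keys (extend f u) \<subseteq> S"
  unfolding extend_def
  by (intro keys_sum_subset order_trans[OF keys_scale_subset] assms)

lemma bilinear_product_sigma_left:
  "bilinear_product \<phi> c (\<sigma> D) v = extend (\<lambda>E. Poly_Mapping.map \<phi> (c D E)) v"
  by (simp add: bilinear_product_def extend_def lookup_sigma)

text \<open>Two nested linear extensions, obtained by pulling the left coefficient out of the inner
  sum; linearity in the left factor is then immediate.\<close>

lemma bilinear_product_alt:
  "bilinear_product \<phi> c u v = extend (\<lambda>D. extend (\<lambda>E. Poly_Mapping.map \<phi> (c D E)) v) u"
  by (simp add: bilinear_product_def extend_def schubert.scale_sum_right)

lemma linear_op_bilinear_product: "linear_op (\<lambda>u. bilinear_product \<phi> c u v)"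
  unfolding bilinear_product_alt by (rule linear_op_extend)

section \<open>Homogeneity, with \<open>q\<close> in degree \<open>n\<close>\<close>

definition homogeneous :: "nat \<Rightarrow> nat \<Rightarrow> int poly schubert_comb \<Rightarrow> bool" where
  "homogeneous n d u \<longleftrightarrow>
     (\<forall>G i. coeff (Poly_Mapping.lookup u G) i \<noteq> 0 \<longrightarrow> sum_list G + n * i = d)"

lemma homogeneous_0: "homogeneous n d 0"
  by (simp add: homogeneous_def)

lemma homogeneous_sigma: "homogeneous n (sum_list D) (\<sigma> D)"
  by (auto simp: homogeneous_def lookup_sigma split: if_splits)

lemma homogeneous_add: "homogeneous n d u \<Longrightarrow> homogeneous n d v \<Longrightarrow> homogeneous n d (u + v)"
  unfolding homogeneous_def lookup_add coeff_add by (metis add_0)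

lemma homogeneous_diff: "homogeneous n d u \<Longrightarrow> homogeneous n d v \<Longrightarrow> homogeneous n d (u - v)"
  unfolding homogeneous_def lookup_minus coeff_diff by (metis diff_0_right)

lemma homogeneous_sum:
  "(\<And>a. a \<in> A \<Longrightarrow> homogeneous n d (f a)) \<Longrightarrow> homogeneous n d (\<Sum>a\<in>A. f a)"
  by (induction A rule: infinite_finite_induct) (auto simp: homogeneous_0 homogeneous_add)

lemma homogeneous_scale:
  assumes "homogeneous n d u" "\<And>i. coeff p i \<noteq> 0 \<Longrightarrow> d + n * i = e"
  shows "homogeneous n e (scale p u)"
  unfolding homogeneous_def
proof (intro allI impI)
  fix G i
  assume "coeff (Poly_Mapping.lookup (scale p u) G) i \<noteq> 0"
  then have "(\<Sum>k\<le>i. coeff p k * coeff (Poly_Mapping.lookup u G) (i - k)) \<noteq> 0"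
    by (simp add: coeff_mult)
  \<comment> \<open>A nonzero convolution sum has a nonzero term, which splits the exponent
    \<open>i\<close> into a part from \<open>p\<close> and a part from \<open>u\<close>.\<close>
  then obtain k where "k \<le> i" "coeff p k \<noteq> 0" "coeff (Poly_Mapping.lookup u G) (i - k) \<noteq> 0"
    by (metis (no_types, lifting) atMost_iff mult_zero_left mult_zero_right sum.neutral)
  moreover from this have "sum_list G + n * (i - k) = d" "d + n * k = e"
    using assms by (auto simp: homogeneous_def)
  ultimately show "sum_list G + n * i = e"
    by (metis add.assoc add_mult_distrib2 le_add_diff_inverse2)
qed

lemma homogeneous_linear_op:
  assumes "linear_op T" "\<And>D. D \<in> Poly_Mapping.keys u \<Longrightarrow> homogeneous n (sum_list D + e) (T (\<sigma> D))"
    and "homogeneous n d u"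
  shows "homogeneous n (d + e) (T u)"
  unfolding linear_op_expansion[OF assms(1), of u]
proof (intro homogeneous_sum homogeneous_scale)
  fix D i
  assume "D \<in> Poly_Mapping.keys u"
  then show "homogeneous n (sum_list D + e) (T (\<sigma> D))" by (rule assms)
  assume "coeff (Poly_Mapping.lookup u D) i \<noteq> 0"
  then show "sum_list D + e + n * i = d + e"
    using assms(3) by (auto simp: homogeneous_def)
qed

section \<open>The Pieri operators of the Grassmannian of planes\<close>

abbreviation q :: "int poly" where "q \<equiv> [:0, 1:]"

lemma diagrams_2_iff: "D \<in> diagrams 2 n \<longleftrightarrow> (\<exists>a b. D = [a, b] \<and> b \<le> a \<and> a \<le> n - 2)"
  by (auto simp: diagrams_def length_Suc_conv numeral_2_eq_2)

lemma pieri_add_iff: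
  "D' \<in> pieri_add 2 (m + 2) j [a, b] \<longleftrightarrow>
    (\<exists>c d. D' = [c, d] \<and> d \<le> c \<and> c \<le> m \<and> a \<le> c \<and> c \<le> a + 1 \<and> b \<le> d \<and> d \<le> b + 1 \<and> c + d = a + b + j)"
  unfolding pieri_add_def diagrams_2_iff by (auto simp: numeral_2_eq_2 All_less_Suc)

lemma pieri_remove_iff:
  "n = m + 2 \<Longrightarrow> D' \<in> pieri_remove 2 n j [a, b] \<longleftrightarrow>
    a = m \<and> (\<exists>c. D' = [c, 0] \<and> c \<le> m \<and> c \<le> b \<and> b \<le> c + 1 \<and> c + (m + 2 - j) = a + b)"
  unfolding pieri_remove_def by (auto simp: diagrams_2_iff)

lemma pieri_add_1:
  assumes "b \<le> a" "a \<le> m"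
  shows "pieri_add 2 (m + 2) 1 [a, b]
    = (if a < m then {[a + 1, b]} else {}) \<union> (if b < a then {[a, b + 1]} else {})"
proof (rule Set.set_eqI)
  fix D'
  have "(d \<le> c \<and> c \<le> m \<and> a \<le> c \<and> c \<le> a + 1 \<and> b \<le> d \<and> d \<le> b + 1 \<and> c + d = a + b + 1)
      \<longleftrightarrow> (a < m \<and> c = a + 1 \<and> d = b \<or> b < a \<and> c = a \<and> d = b + 1)" for c d
    using assms by arith
  then show "D' \<in> pieri_add 2 (m + 2) 1 [a, b] \<longleftrightarrow>
    D' \<in> (if a < m then {[a + 1, b]} else {}) \<union> (if b < a then {[a, b + 1]} else {})"
    unfolding pieri_add_iff by auto
qed

lemma pieri_add_2:
  assumes "b \<le> a" "a \<le> m"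
  shows "pieri_add 2 (m + 2) 2 [a, b] = (if a < m then {[a + 1, b + 1]} else {})"
proof (rule Set.set_eqI)
  fix D'
  have "(d \<le> c \<and> c \<le> m \<and> a \<le> c \<and> c \<le> a + 1 \<and> b \<le> d \<and> d \<le> b + 1 \<and> c + d = a + b + 2)
      \<longleftrightarrow> (a < m \<and> c = a + 1 \<and> d = b + 1)" for c d
    using assms by arith
  then show "D' \<in> pieri_add 2 (m + 2) 2 [a, b] \<longleftrightarrow> D' \<in> (if a < m then {[a + 1, b + 1]} else {})"
    unfolding pieri_add_iff by auto
qed

text \<open>Here \<open>n - 1 = m + 1\<close> boxes go: the \<open>m\<close> boxes of the top row
  and one box of the second row, which must therefore be nonempty.\<close>

lemma pieri_remove_1:
  assumes "b \<le> a" "a \<le> m"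
  shows "pieri_remove 2 (m + 2) 1 [a, b] = (if a = m \<and> 0 < b then {[b - 1, 0]} else {})"
  using assms by (intro Set.set_eqI) (auto simp: pieri_remove_iff)

text \<open>Here \<open>n - 2 = m\<close>, so exactly the top row goes and the second row moves up
  intact.\<close>

lemma pieri_remove_2:
  assumes "b \<le> a" "a \<le> m"
  shows "pieri_remove 2 (m + 2) 2 [a, b] = (if a = m then {[b, 0]} else {})"
  using assms by (intro Set.set_eqI) (auto simp: pieri_remove_iff)

text \<open>The value 0 outside the rectangle keeps every image inside the module on the diagrams
  and lets the operators commute without a support condition.\<close>

definition pieri :: "nat \<Rightarrow> nat \<Rightarrow> int poly schubert_comb \<Rightarrow> int poly schubert_comb" where
  "pieri m j = extend (\<lambda>D. if D \<in> diagrams 2 (m + 2)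
     then (\<Sum>D'\<in>pieri_add 2 (m + 2) j D. \<sigma> D') + (\<Sum>D''\<in>pieri_remove 2 (m + 2) j D. scale q (\<sigma> D''))
     else 0)"

lemma pieri_sigma:
  "D \<in> diagrams 2 (m + 2) \<Longrightarrow> pieri m j (\<sigma> D)
    = (\<Sum>D'\<in>pieri_add 2 (m + 2) j D. \<sigma> D') + (\<Sum>D''\<in>pieri_remove 2 (m + 2) j D. scale q (\<sigma> D''))"
  by (simp add: pieri_def)

lemma pieri_1:
  assumes "b \<le> a" "a \<le> m"
  shows "pieri m (Suc 0) (\<sigma> [a, b]) = (if a < m then \<sigma> [a + 1, b] else 0)
    + (if b < a then \<sigma> [a, b + 1] else 0) + (if a = m \<and> 0 < b then scale q (\<sigma> [b - 1, 0]) else 0)"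
proof -
  have "[a, b] \<in> diagrams 2 (m + 2)" using assms by (simp add: diagrams_2_iff)
  then show ?thesis
    using pieri_add_1[OF assms] pieri_remove_1[OF assms] by (simp add: pieri_sigma)
qed

lemma pieri_2:
  assumes "b \<le> a" "a \<le> m"
  shows "pieri m 2 (\<sigma> [a, b]) = (if a < m then \<sigma> [a + 1, b + 1] else scale q (\<sigma> [b, 0]))"
proof -
  have "[a, b] \<in> diagrams 2 (m + 2)" using assms by (simp add: diagrams_2_iff)
  then show ?thesis
    using pieri_add_2[OF assms] pieri_remove_2[OF assms] assms by (simp add: pieri_sigma)
qed

lemma linear_op_pieri: "linear_op (pieri m j)"
  unfolding pieri_def by (rule linear_op_extend)

lemma pieri_zero [simp]: "pieri m j 0 = 0"
  by (rule module_hom.zero[OF linear_op_pieri])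

lemma pieri_outside: "D \<notin> diagrams 2 (m + 2) \<Longrightarrow> pieri m j (\<sigma> D) = 0"
  by (simp add: pieri_def)

lemma keys_pieri: "Poly_Mapping.keys (pieri m j u) \<subseteq> diagrams 2 (m + 2)"
  unfolding pieri_def
proof (rule keys_extend)
  fix D
  have "Poly_Mapping.keys ((\<Sum>D'\<in>pieri_add 2 (m + 2) j D. \<sigma> D' :: int poly schubert_comb)
      + (\<Sum>D''\<in>pieri_remove 2 (m + 2) j D. scale q (\<sigma> D''))) \<subseteq> diagrams 2 (m + 2)"
    by (intro order_trans[OF Poly_Mapping.keys_add] Un_least keys_sum_subset
        order_trans[OF keys_scale_subset])
       (auto simp: pieri_add_def pieri_remove_def split: if_splits)
  then show "Poly_Mapping.keys (if D \<in> diagrams 2 (m + 2)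
     then (\<Sum>D'\<in>pieri_add 2 (m + 2) j D. \<sigma> D') + (\<Sum>D''\<in>pieri_remove 2 (m + 2) j D. scale q (\<sigma> D''))
     else 0) \<subseteq> diagrams 2 (m + 2)"
    by simp
qed

lemma linear_op_comp: "linear_op S \<Longrightarrow> linear_op T \<Longrightarrow> linear_op (\<lambda>u. S (T u))"
  using Modules.module_hom_compose[of scale scale T scale S] by (simp add: o_def)

lemma homogeneous_pieri:
  assumes "homogeneous (m + 2) d u" "j \<le> m + 2"
  shows "homogeneous (m + 2) (d + j) (pieri m j u)"
proof (rule homogeneous_linear_op[OF linear_op_pieri _ assms(1)])
  fix D
  show "homogeneous (m + 2) (sum_list D + j) (pieri m j (\<sigma> D))"
  proof (cases "D \<in> diagrams 2 (m + 2)")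
    case True
    have "homogeneous (m + 2) (sum_list D + j) (\<sigma> E)" if "E \<in> pieri_add 2 (m + 2) j D" for E
      using homogeneous_sigma[of "m + 2" E] that by (auto simp: pieri_add_def)
    moreover have "homogeneous (m + 2) (sum_list D + j) (scale q (\<sigma> E))"
      if "E \<in> pieri_remove 2 (m + 2) j D" for E
    proof (rule homogeneous_scale[OF homogeneous_sigma])
      fix i assume "coeff q i \<noteq> 0"
      then have "i = 1" by (auto simp: coeff_pCons split: nat.splits)
      \<comment> \<open>\<open>pieri_remove\<close> takes away \<open>m + 2 - j\<close> boxes, a
        true difference since \<open>j \<le> m + 2\<close>; the factor \<open>q\<close> has degree
        \<open>m + 2\<close>, so the net gain is \<open>j\<close>.\<close>
      then show "sum_list E + (m + 2) * i = sum_list D + j"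
        using that assms(2) by (auto simp: pieri_remove_def split: if_splits)
    qed
    ultimately show ?thesis
      unfolding pieri_sigma[OF True] by (intro homogeneous_add homogeneous_sum) auto
  next
    case False
    then show ?thesis by (simp add: pieri_outside homogeneous_0)
  qed
qed

text \<open>\<open>pieri m 2\<close> either adds a column of two boxes or trades a full top row for
  \<open>q\<close>, whence the case split. If the top row is full, both orders give \<open>q\<close>
  times the classes of \<open>[b + 1, 0]\<close> (for \<open>b < m\<close>) and
  \<open>[b, 1]\<close> (for \<open>0 < b\<close>).\<close>

lemma pieri_commute_sigma: "pieri m (Suc 0) (pieri m 2 (\<sigma> D)) = pieri m 2 (pieri m (Suc 0) (\<sigma> D))"
proof (cases "D \<in> diagrams 2 (m + 2)")
  case True
  interpret X1: module_hom scale scale "pieri m (Suc 0)" by (rule linear_op_pieri)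
  interpret X2: module_hom scale scale "pieri m 2" by (rule linear_op_pieri)
  from True obtain a b where D: "D = [a, b]" "b \<le> a" "a \<le> m" by (auto simp: diagrams_2_iff)
  show ?thesis
  proof (cases "a < m")
    case True
    then show ?thesis using D
      by (auto simp: pieri_1 pieri_2 X1.add X2.add X1.scale X2.scale not_less)
  next
    case False
    then have "a = m" using D by simp
    then show ?thesis using D
      by (auto simp: pieri_1 pieri_2 X1.add X2.add X1.scale X2.scale schubert.scale_right_distrib)
  qed
qed (simp add: pieri_outside)

lemma pieri_commute: "pieri m (Suc 0) (pieri m 2 u) = pieri m 2 (pieri m (Suc 0) u)"
proof -
  have comp: "linear_op (\<lambda>u. pieri m i (pieri m j u))" for i j
    by (rule linear_op_comp[OF linear_op_pieri linear_op_pieri])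
  show ?thesis
    by (rule linear_op_eqI[OF comp comp pieri_commute_sigma])
qed

section \<open>The quantum product\<close>

text \<open>The complete homogeneous polynomials, by \<open>h_(a+2) = e_1 h_(a+1) - e_2 h_a\<close>,
  with the Pieri operators as \<open>e_1\<close> and \<open>e_2\<close>.\<close>

fun row_op :: "nat \<Rightarrow> nat \<Rightarrow> int poly schubert_comb \<Rightarrow> int poly schubert_comb" where
  "row_op m 0 u = u"
| "row_op m (Suc 0) u = pieri m (Suc 0) u"
| "row_op m (Suc (Suc a)) u = pieri m (Suc 0) (row_op m (Suc a) u) - pieri m 2 (row_op m a u)"

text \<open>The Schur polynomial in two variables, \<open>s_(a,b) = e_2^b h_(a-b)\<close>, at the
  Pieri operators.\<close>

definition schur_op :: "nat \<Rightarrow> nat list \<Rightarrow> int poly schubert_comb \<Rightarrow> int poly schubert_comb" where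
  "schur_op m D u = (pieri m 2 ^^ (D ! 1)) (row_op m (D ! 0 - D ! 1) u)"

section \<open>Operators commuting with both Pieri operators\<close>

definition commutant :: "nat \<Rightarrow> (int poly schubert_comb \<Rightarrow> int poly schubert_comb) \<Rightarrow> bool" where
  "commutant m T \<longleftrightarrow> linear_op T \<and> (\<forall>u. T (pieri m (Suc 0) u) = pieri m (Suc 0) (T u))
     \<and> (\<forall>u. T (pieri m 2 u) = pieri m 2 (T u))"

lemma commutant_id: "commutant m (\<lambda>u. u)"
  unfolding commutant_def using linear_opI[of "\<lambda>u. u"] by auto

lemma commutant_comp: "commutant m S \<Longrightarrow> commutant m T \<Longrightarrow> commutant m (\<lambda>u. S (T u))"
  unfolding commutant_def by (simp add: linear_op_comp)

lemma commutant_pieri: "commutant m (pieri m (Suc 0))" "commutant m (pieri m 2)"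
  unfolding commutant_def by (simp_all add: linear_op_pieri pieri_commute)

lemma pieri_diff: "pieri m j (u - v) = pieri m j u - pieri m j v"
  by (rule module_hom.diff[OF linear_op_pieri])

lemma pieri_add: "pieri m j (u + v) = pieri m j u + pieri m j v"
  by (rule module_hom.add[OF linear_op_pieri])

lemma pieri_scale: "pieri m j (scale r u) = scale r (pieri m j u)"
  by (rule module_hom.scale[OF linear_op_pieri])

lemma pieri_sum: "pieri m j (\<Sum>a\<in>A. f a) = (\<Sum>a\<in>A. pieri m j (f a))"
  by (rule module_hom.sum[OF linear_op_pieri])

lemma commutant_diff:
  assumes "commutant m S" "commutant m T"
  shows "commutant m (\<lambda>u. S u - T u)"
proof -
  interpret S: module_hom scale scale S using assms by (simp add: commutant_def)
  interpret T: module_hom scale scale T using assms by (simp add: commutant_def)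
  have "linear_op (\<lambda>u. S u - T u)"
    by (rule linear_opI) (simp_all add: S.add T.add S.scale T.scale schubert.scale_right_diff_distrib)
  then show ?thesis using assms by (simp add: commutant_def pieri_diff)
qed

lemma commutant_scale:
  assumes "commutant m T"
  shows "commutant m (\<lambda>u. scale r (T u))"
proof -
  interpret T: module_hom scale scale T using assms by (simp add: commutant_def)
  have "linear_op (\<lambda>u. scale r (T u))"
    by (rule linear_opI)
       (simp_all add: T.add T.scale schubert.scale_right_distrib mult.commute)
  then show ?thesis using assms by (simp add: commutant_def pieri_scale)
qed

lemma commutant_sum:
  assumes "\<And>a. a \<in> A \<Longrightarrow> commutant m (T a)"
  shows "commutant m (\<lambda>u. \<Sum>a\<in>A. T a u)"
proof -
  have T: "linear_op (T a)" if "a \<in> A" for a using assms that by (simp add: commutant_def)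
  have "linear_op (\<lambda>u. \<Sum>a\<in>A. T a u)"
    by (rule linear_opI)
       (simp_all add: module_hom.add[OF T] module_hom.scale[OF T] sum.distrib schubert.scale_sum_right)
  then show ?thesis using assms by (simp add: commutant_def pieri_sum)
qed

lemma commutant_row_op: "commutant m (row_op m a)"
proof (induction a rule: induct_nat_012)
  case (ge2 a)
  have "commutant m (\<lambda>u. pieri m (Suc 0) (row_op m (Suc a) u) - pieri m 2 (row_op m a u))"
    by (intro commutant_diff commutant_comp[OF commutant_pieri(1)] commutant_comp[OF commutant_pieri(2)]
        ge2)
  then show ?case by simp
qed (simp_all add: commutant_id commutant_pieri)

lemma commutant_funpow: "commutant m T \<Longrightarrow> commutant m (T ^^ b)"
  by (induction b) (simp_all add: commutant_id commutant_comp id_def o_def)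

lemma commutant_schur_op: "commutant m (schur_op m D)"
  unfolding schur_op_def
  by (rule commutant_comp[OF commutant_funpow[OF commutant_pieri(2)] commutant_row_op])

text \<open>\<open>schur_op m D\<close> is a polynomial in the two Pieri operators.\<close>

lemma commutant_commute_schur_op:
  assumes "commutant m T"
  shows "T (schur_op m D u) = schur_op m D (T u)"
proof -
  interpret T: module_hom scale scale T using assms by (simp add: commutant_def)
  have "T (row_op m a u) = row_op m a (T u)" for a
    using assms by (induction a rule: induct_nat_012) (simp_all add: commutant_def T.diff)
  moreover have "T ((pieri m 2 ^^ b) w) = (pieri m 2 ^^ b) (T w)" for b w
    using assms by (induction b) (simp_all add: commutant_def)
  ultimately show ?thesis by (simp add: schur_op_def)
qed

text \<open>The unit generates the module. No \<open>q\<close>-term occurs while the top row stays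
  within \<open>m\<close>: for single rows, the extra class \<open>[a + 1, 1]\<close> in
  \<open>X_1 \<sigma> [a + 1, 0]\<close> cancels against \<open>X_2 \<sigma> [a, 0]\<close>, and
  each later \<open>X_2\<close> adds a column.\<close>

lemma schur_op_unit:
  assumes "D \<in> diagrams 2 (m + 2)"
  shows "schur_op m D (\<sigma> [0, 0]) = \<sigma> D"
proof -
  obtain a b where D: "D = [a, b]" "b \<le> a" "a \<le> m" using assms by (auto simp: diagrams_2_iff)
  have row: "a \<le> m \<Longrightarrow> row_op m a (\<sigma> [0, 0]) = \<sigma> [a, 0]" for a
    by (induction a rule: induct_nat_012) (auto simp: pieri_1 pieri_2)
  have "a + b \<le> m \<Longrightarrow> (pieri m 2 ^^ b) (\<sigma> [a, 0]) = \<sigma> [a + b, b]" for a b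
    by (induction b) (auto simp: pieri_2)
  from this[of "a - b" b] row[of "a - b"] show ?thesis using D by (simp add: schur_op_def)
qed

lemma keys_schur_op:
  assumes "Poly_Mapping.keys u \<subseteq> diagrams 2 (m + 2)"
  shows "Poly_Mapping.keys (schur_op m D u) \<subseteq> diagrams 2 (m + 2)"
proof -
  have "Poly_Mapping.keys (v - w) \<subseteq> diagrams 2 (m + 2)"
    if "Poly_Mapping.keys v \<subseteq> diagrams 2 (m + 2)" "Poly_Mapping.keys w \<subseteq> diagrams 2 (m + 2)"
    for v w :: "int poly schubert_comb"
    using that unfolding subset_iff in_keys_iff lookup_minus by (metis diff_self)
  then have "Poly_Mapping.keys (row_op m a u) \<subseteq> diagrams 2 (m + 2)" for a
    by (induction a rule: induct_nat_012) (use assms keys_pieri in auto)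
  then show ?thesis
    unfolding schur_op_def by (cases "D ! 1") (use keys_pieri in auto)
qed

lemma homogeneous_schur_op:
  assumes "homogeneous (m + 2) d u" "D \<in> diagrams 2 (m + 2)"
  shows "homogeneous (m + 2) (d + sum_list D) (schur_op m D u)"
proof -
  have row: "homogeneous (m + 2) (d + a) (row_op m a u)" for a
  proof (induction a rule: induct_nat_012)
    case 1
    show ?case using homogeneous_pieri[OF assms(1), of 1] by simp
  next
    case (ge2 a)
    from homogeneous_pieri[OF ge2(2), of 1] homogeneous_pieri[OF ge2(1), of 2] show ?case
      by (auto intro!: homogeneous_diff)
  qed (use assms in simp)
  have "homogeneous (m + 2) (e + 2 * b) ((pieri m 2 ^^ b) w)" if "homogeneous (m + 2) e w" for e b w
  proof (induction b)
    case (Suc b)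
    from homogeneous_pieri[OF this, of 2] show ?case by (simp add: add.commute add.left_commute)
  qed (use that in simp)
  from this[OF row] have "homogeneous (m + 2) (d + (a - b) + 2 * b) ((pieri m 2 ^^ b) (row_op m (a - b) u))" for a b .
  moreover obtain a b where "D = [a, b]" "b \<le> a" using assms(2) by (auto simp: diagrams_2_iff)
  moreover from this have "d + (a - b) + 2 * b = d + sum_list D" by simp
  ultimately show ?thesis by (metis schur_op_def nth_Cons_0 nth_Cons_Suc One_nat_def)
qed

text \<open>Both operators commute with \<open>schur_op m D\<close>, which carries the unit to
  \<open>\<sigma> D\<close>, so agreement at the unit spreads to every class.\<close>

lemma commutant_eqI:
  assumes "commutant m S" "commutant m T" "S (\<sigma> [0, 0]) = T (\<sigma> [0, 0])"
    and "Poly_Mapping.keys u \<subseteq> diagrams 2 (m + 2)"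
  shows "S u = T u"
proof (rule linear_op_eqI[where S = S and T = T])
  show "linear_op S" "linear_op T" using assms by (auto simp: commutant_def)
  fix D
  assume "D \<in> Poly_Mapping.keys u"
  then have D: "schur_op m D (\<sigma> [0, 0]) = \<sigma> D" using assms(4) schur_op_unit by blast
  show "S (\<sigma> D) = T (\<sigma> D)"
    using commutant_commute_schur_op[OF assms(1), of D "\<sigma> [0, 0]"]
      commutant_commute_schur_op[OF assms(2), of D "\<sigma> [0, 0]"] assms(3) D by simp
qed

section \<open>Existence of the quantum product\<close>

definition schur_table :: "nat \<Rightarrow> product_table" where
  "schur_table m D E =
     (if D \<in> diagrams 2 (m + 2) \<and> E \<in> diagrams 2 (m + 2) then schur_op m D (\<sigma> E) else 0)"

lemma bilinear_product_schur_table: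
  assumes "Poly_Mapping.keys u \<subseteq> diagrams 2 (m + 2)" "Poly_Mapping.keys v \<subseteq> diagrams 2 (m + 2)"
  shows "bilinear_product id (schur_table m) u v
    = (\<Sum>D\<in>Poly_Mapping.keys u. scale (Poly_Mapping.lookup u D) (schur_op m D v))"
proof -
  have "extend (schur_table m D) v = schur_op m D v" if "D \<in> diagrams 2 (m + 2)" for D
    by (rule linear_op_eqI[OF linear_op_extend])
       (use assms that commutant_schur_op[of m D] in \<open>auto simp: commutant_def schur_table_def\<close>)
  then show ?thesis
    unfolding bilinear_product_alt extend_def[of _ u]
    using assms(1) by (auto intro!: sum.cong)
qed

text \<open>The core of associativity. As functions of \<open>v\<close> both sides come from the
  commutant, so it suffices to compare them at the unit, where each gives
  \<open>schur_op m D (\<sigma> E)\<close>.\<close>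

lemma schur_op_schur_op:
  assumes "D \<in> diagrams 2 (m + 2)" "E \<in> diagrams 2 (m + 2)" "Poly_Mapping.keys v \<subseteq> diagrams 2 (m + 2)"
  shows "bilinear_product id (schur_table m) (schur_op m D (\<sigma> E)) v = schur_op m D (schur_op m E v)"
proof -
  define u where "u = schur_op m D (\<sigma> E)"
  have u: "Poly_Mapping.keys u \<subseteq> diagrams 2 (m + 2)"
    unfolding u_def using assms by (intro keys_schur_op) simp
  let ?T = "\<lambda>v. \<Sum>D\<in>Poly_Mapping.keys u. scale (Poly_Mapping.lookup u D) (schur_op m D v)"
  have "?T v = schur_op m D (schur_op m E v)"
  proof (rule commutant_eqI[where S = ?T and T = "\<lambda>v. schur_op m D (schur_op m E v)"])
    show "commutant m ?T"
      by (intro commutant_sum commutant_scale commutant_schur_op)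
    show "commutant m (\<lambda>v. schur_op m D (schur_op m E v))"
      by (rule commutant_comp[OF commutant_schur_op commutant_schur_op])
    have "?T (\<sigma> [0, 0]) = (\<Sum>D\<in>Poly_Mapping.keys u. scale (Poly_Mapping.lookup u D) (\<sigma> D))"
      using u by (intro sum.cong) (auto simp: subset_iff schur_op_unit)
    also have "\<dots> = u" by (rule schubert_expansion[symmetric]) simp_all
    finally show "?T (\<sigma> [0, 0]) = schur_op m D (schur_op m E (\<sigma> [0, 0]))"
      using schur_op_unit[OF assms(2)] by (simp add: u_def)
  qed fact
  then show ?thesis
    using bilinear_product_schur_table[OF u assms(3)] by (simp add: u_def)
qed

lemma is_quantum_product_schur_table:
  assumes "1 \<le> m"
  shows "is_quantum_product 2 (m + 2) (schur_table m)"
  unfolding is_quantum_product_def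
proof (intro conjI allI ballI impI)
  fix D E
  show "Poly_Mapping.keys (schur_table m D E) \<subseteq> diagrams 2 (m + 2)"
    unfolding schur_table_def using keys_schur_op[of "\<sigma> E" m D] by auto
next
  fix D E
  assume "D \<notin> diagrams 2 (m + 2) \<or> E \<notin> diagrams 2 (m + 2)"
  then show "schur_table m D E = 0" by (auto simp: schur_table_def)
next
  fix D E G i
  assume "D \<in> diagrams 2 (m + 2)" "E \<in> diagrams 2 (m + 2)"
    and "coeff (Poly_Mapping.lookup (schur_table m D E) G) i \<noteq> 0"
  moreover from this have "homogeneous (m + 2) (sum_list E + sum_list D) (schur_op m D (\<sigma> E))"
    by (intro homogeneous_schur_op homogeneous_sigma)
  ultimately show "sum_list G + (m + 2) * i = sum_list D + sum_list E"
    by (simp add: homogeneous_def schur_table_def)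
next
  fix D E
  assume D: "D \<in> diagrams 2 (m + 2)" and E: "E \<in> diagrams 2 (m + 2)"
  \<comment> \<open>Since \<open>\<sigma> E\<close> and \<open>\<sigma> D\<close> are the images of
    the unit, symmetry of the table is commutation of the two operators.\<close>
  have "schur_op m D (schur_op m E (\<sigma> [0, 0])) = schur_op m E (schur_op m D (\<sigma> [0, 0]))"
    by (rule commutant_commute_schur_op[OF commutant_schur_op])
  then show "schur_table m D E = schur_table m E D"
    using D E by (simp only: schur_table_def schur_op_unit simp_thms if_True)
next
  fix D E G
  assume D: "D \<in> diagrams 2 (m + 2)" and E: "E \<in> diagrams 2 (m + 2)" and G: "G \<in> diagrams 2 (m + 2)"
  have "bilinear_product id (schur_table m) (\<sigma> D) (schur_op m E (\<sigma> G)) = schur_op m D (schur_op m E (\<sigma> G))"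
    using D G keys_schur_op[of "\<sigma> G" m E] by (simp add: bilinear_product_schur_table lookup_sigma del: add_2_eq_Suc')
  then show "bilinear_product id (schur_table m) (schur_table m D E) (\<sigma> G)
      = bilinear_product id (schur_table m) (\<sigma> D) (schur_table m E G)"
    using schur_op_schur_op[OF D E, of "\<sigma> G"] D E G by (simp add: schur_table_def)
next
  fix D
  assume "D \<in> diagrams 2 (m + 2)"
  moreover have "[0, 0] \<in> diagrams 2 (m + 2)" by (simp add: diagrams_2_iff)
  ultimately show "schur_table m (empty_diagram 2) D = \<sigma> D"
    by (simp add: schur_table_def empty_diagram_def numeral_2_eq_2 schur_op_def)
next
  \<comment> \<open>\<open>1 \<le> m\<close> makes the columns \<open>[1, 0]\<close> and
    \<open>[1, 1]\<close> fit; their Schur polynomials are \<open>e_1\<close> and \<open>e_2\<close>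
    themselves.\<close>
  have "column 2 j \<in> diagrams 2 (m + 2) \<and> schur_op m (column 2 j) u = pieri m j u" if "j \<in> {1..2}" for j u
  proof -
    from that consider "j = 1" | "j = 2" by fastforce
    moreover have "column 2 1 = [1, 0]" "column 2 2 = [1, 1]" by (simp_all add: column_def numeral_2_eq_2)
    ultimately show ?thesis
      using assms by cases (simp_all add: diagrams_2_iff schur_op_def)
  qed
  then show "satisfies_pieri 2 (m + 2) (schur_table m)"
    unfolding satisfies_pieri_def by (simp add: schur_table_def pieri_sigma)
qed

text \<open>The Pieri rule fixes multiplication by the two columns. Associativity turns the Pieri
  expansions of column times class into the recursions that define \<open>schur_op\<close>.\<close>

lemma quantum_product_unique:
  assumes "1 \<le> m" "is_quantum_product 2 (m + 2) c"
  shows "c = schur_table m"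
proof -
  have zero: "\<And>D E. D \<notin> diagrams 2 (m + 2) \<or> E \<notin> diagrams 2 (m + 2) \<Longrightarrow> c D E = 0"
    and keys: "\<And>D E. Poly_Mapping.keys (c D E) \<subseteq> diagrams 2 (m + 2)"
    and assoc: "\<And>D E G. D \<in> diagrams 2 (m + 2) \<Longrightarrow> E \<in> diagrams 2 (m + 2) \<Longrightarrow> G \<in> diagrams 2 (m + 2)
      \<Longrightarrow> bilinear_product id c (c D E) (\<sigma> G) = bilinear_product id c (\<sigma> D) (c E G)"
    and unit: "\<And>D. D \<in> diagrams 2 (m + 2) \<Longrightarrow> c (empty_diagram 2) D = \<sigma> D"
    and pieri: "satisfies_pieri 2 (m + 2) c"
    using assms(2) unfolding is_quantum_product_def by blast+
  have dia: "[1, 0] \<in> diagrams 2 (m + 2)" "[1, 1] \<in> diagrams 2 (m + 2)"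
    using assms(1) by (simp_all add: diagrams_2_iff)
  have col: "column 2 1 = [1, 0]" "column 2 2 = [1, 1]" by (simp_all add: column_def numeral_2_eq_2)
  have c1: "c [1, 0] D = pieri m (Suc 0) (\<sigma> D)" and c2: "c [1, 1] D = pieri m 2 (\<sigma> D)"
    if "D \<in> diagrams 2 (m + 2)" for D
    using pieri that unfolding satisfies_pieri_def col[symmetric] by (simp_all add: pieri_sigma)
  have b1: "bilinear_product id c (\<sigma> [1, 0]) u = pieri m (Suc 0) u"
    and b2: "bilinear_product id c (\<sigma> [1, 1]) u = pieri m 2 u"
    if "Poly_Mapping.keys u \<subseteq> diagrams 2 (m + 2)" for u
    unfolding bilinear_product_sigma_left map_id
    by (rule linear_op_eqI[OF linear_op_extend linear_op_pieri]; use that c1 c2 in auto)+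
  have sig: "bilinear_product id c (\<sigma> D) (\<sigma> G) = c D G" for D G
    by (simp add: bilinear_product_sigma_left)
  interpret L: module_hom scale scale "\<lambda>u. bilinear_product id c u v" for v
    by (rule linear_op_bilinear_product)
  \<comment> \<open>As \<open>a < m\<close>, the product of \<open>[1, 1]\<close> with
    \<open>[a, b]\<close> is a single class without \<open>q\<close>, and associativity moves the
    factor \<open>[1, 1]\<close> outside.\<close>
  have step2: "c [Suc a, Suc b] G = pieri m 2 (c [a, b] G)"
    if "b \<le> a" "Suc a \<le> m" "G \<in> diagrams 2 (m + 2)" for a b G
  proof -
    have "[a, b] \<in> diagrams 2 (m + 2)" using that by (simp add: diagrams_2_iff)
    from assoc[OF dia(2) this that(3)] b2[OF keys, of "[a, b]" G] c2[OF this] pieri_2[of b a m] that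
    show ?thesis by (simp add: sig)
  qed
  have row: "c [a, 0] G = row_op m a (\<sigma> G)" if "a \<le> m" "G \<in> diagrams 2 (m + 2)" for a G
    using that(1)
  proof (induction a rule: induct_nat_012)
    case 0
    show ?case using unit[OF that(2)] by (simp add: empty_diagram_def numeral_2_eq_2)
  next
    case 1
    show ?case using c1[OF that(2)] by simp
  next
    case (ge2 a)
    have "[Suc a, 0] \<in> diagrams 2 (m + 2)" using ge2 by (simp add: diagrams_2_iff)
    \<comment> \<open>The product of \<open>[1, 0]\<close> with \<open>[Suc a, 0]\<close> has two
      terms. The unwanted one, \<open>[Suc a, 1]\<close>, is \<open>[1, 1]\<close> times
      \<open>[a, 0]\<close> by \<open>step2\<close>, which leaves the recursion of
      \<open>row_op\<close>.\<close>
    from assoc[OF dia(1) this that(2)] b1[OF keys, of "[Suc a, 0]" G] c1[OF this]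
      pieri_1[of 0 "Suc a" m] ge2
    have "c [Suc (Suc a), 0] G + c [Suc a, Suc 0] G = pieri m (Suc 0) (c [Suc a, 0] G)"
      by (simp add: sig L.add)
    with step2[of 0 a G] ge2 that(2) show ?case by (simp add: algebra_simps)
  qed
  have "c [a + b, b] G = (pieri m 2 ^^ b) (row_op m a (\<sigma> G))"
    if "a + b \<le> m" "G \<in> diagrams 2 (m + 2)" for a b G
    using that(1)
  proof (induction b)
    case 0
    then show ?case using row that(2) by simp
  next
    case (Suc b)
    then show ?case using step2[of b "a + b" G] that(2) by simp
  qed
  then have "c [a, b] G = schur_op m [a, b] (\<sigma> G)"
    if "b \<le> a" "a \<le> m" "G \<in> diagrams 2 (m + 2)" for a b G
    using that unfolding schur_op_def by (metis le_add_diff_inverse2 nth_Cons_0 nth_Cons_Suc One_nat_def)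
  then have "c D E = schur_table m D E" for D E
    using zero[of D E] unfolding schur_table_def by (auto simp: diagrams_2_iff)
  then show ?thesis by blast
qed

lemma quantum_table_eq:
  assumes "1 \<le> m"
  shows "quantum_table 2 (m + 2) = schur_table m"
  unfolding quantum_table_def
  using is_quantum_product_schur_table[OF assms] quantum_product_unique[OF assms]
  by (rule the_equality)

section \<open>The characteristic polynomial\<close>

text \<open>Separate corners keep the recursion in one family: deleting the last row and column puts
  \<open>s\<close> in the last corner. At size 1 the first corner \<open>a\<close> prevails.\<close>

definition tridiagonal :: "'a::comm_ring_1 \<Rightarrow> 'a \<Rightarrow> 'a \<Rightarrow> nat \<Rightarrow> 'a mat" where
  "tridiagonal a s b n = mat n n (\<lambda>(i, j).
     if i = j then (if i = 0 then a else if i = n - 1 then b else s)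
     else if i = j + 1 \<or> j = i + 1 then - 1 else 0)"

text \<open>The three-term recurrence of continuants, by expansion along the last row.\<close>

lemma det_tridiagonal:
  "det (tridiagonal a s b (Suc (Suc n)))
    = b * det (tridiagonal a s s (Suc n)) - det (tridiagonal a s s n)"
proof -
  let ?A = "tridiagonal a s b (Suc (Suc n))"
  let ?B = "mat_delete ?A (Suc n) n"
  have A: "?A \<in> carrier_mat (Suc (Suc n)) (Suc (Suc n))" by (simp add: tridiagonal_def)
  have B: "?B \<in> carrier_mat (Suc n) (Suc n)"
    by (simp add: mat_delete_def tridiagonal_def)
  have delA: "mat_delete ?A (Suc n) (Suc n) = tridiagonal a s s (Suc n)"
    by (rule eq_matI) (auto simp: tridiagonal_def mat_delete_def)
  have delB: "mat_delete ?B n n = tridiagonal a s s n"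
    by (rule eq_matI) (auto simp: tridiagonal_def mat_delete_def)
  \<comment> \<open>The last column of \<open>?B\<close> has a single nonzero entry, the
    \<open>- 1\<close> at its bottom.\<close>
  have "det ?B = (\<Sum>i<Suc n. ?B $$ (i, n) * cofactor ?B i n)"
    by (rule laplace_expansion_column[OF B]) simp
  also have "\<dots> = ?B $$ (n, n) * cofactor ?B n n"
    by (simp add: tridiagonal_def mat_delete_def)
  also have "\<dots> = - det (tridiagonal a s s n)"
    unfolding cofactor_def delB by (simp add: tridiagonal_def mat_delete_def)
  finally have detB: "det ?B = - det (tridiagonal a s s n)" .
  have "det ?A = (\<Sum>j<Suc (Suc n). ?A $$ (Suc n, j) * cofactor ?A (Suc n) j)"
    by (rule laplace_expansion_row[OF A]) simp
  also have "\<dots> = (\<Sum>j\<in>{n, Suc n}. ?A $$ (Suc n, j) * cofactor ?A (Suc n) j)"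
    by (rule sum.mono_neutral_right) (auto simp: tridiagonal_def)
  \<comment> \<open>The entry \<open>- 1\<close> left of the corner cancels the negative sign of its
    cofactor.\<close>
  also have "\<dots> = b * det (tridiagonal a s s (Suc n)) + det ?B"
    unfolding cofactor_def by (simp add: delA) (simp add: tridiagonal_def)
  finally show ?thesis using detB by simp
qed

text \<open>With \<open>y = x^(-1)\<close> the determinant is \<open>x^(-n) + ... + x^n\<close>, a
  solution of the recurrence with coefficient \<open>x + y\<close>; the factor \<open>x ^ n\<close>
  clears denominators.\<close>

lemma det_tridiagonal_left:
  fixes x y :: "'a::comm_ring_1"
  assumes "x * y = 1"
  shows "x ^ n * det (tridiagonal (x + y + 1) (x + y) (x + y) n) = (\<Sum>i\<le>2 * n. x ^ i)"
proof (induction n rule: induct_nat_012)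
  case 0
  have "tridiagonal (x + y + 1) (x + y) (x + y) 0 \<in> carrier_mat 0 0" by (simp add: tridiagonal_def)
  then show ?case using det_dim_zero by simp
next
  case 1
  show ?case using assms by (simp add: det_single tridiagonal_def algebra_simps power2_eq_square numeral_2_eq_2)
next
  case (ge2 n)
  let ?V = "\<lambda>n. det (tridiagonal (x + y + 1) (x + y) (x + y) n)"
  \<comment> \<open>The first power beyond the sum up to \<open>2 * n\<close>, so that the longer
    sums can be expressed through the shorter one.\<close>
  define a where "a = x ^ (2 * n + 1)"
  have "x ^ Suc (Suc n) * ?V (Suc (Suc n))
      = (x\<^sup>2 + x * y) * (x ^ Suc n * ?V (Suc n)) - x\<^sup>2 * (x ^ n * ?V n)"
    unfolding det_tridiagonal by (simp add: algebra_simps power2_eq_square)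
  also have "\<dots> = (x\<^sup>2 + 1) * (\<Sum>i\<le>2 * Suc n. x ^ i) - x\<^sup>2 * (\<Sum>i\<le>2 * n. x ^ i)"
    by (simp only: ge2 assms)
  also have "\<dots> = (\<Sum>i\<le>2 * n. x ^ i) + a + a * x + a * x\<^sup>2 + a * x\<^sup>2 * x"
    by (simp add: a_def algebra_simps power2_eq_square)
  also have "\<dots> = (\<Sum>i\<le>2 * Suc (Suc n). x ^ i)"
    by (simp add: a_def algebra_simps power2_eq_square)
  finally show ?case .
qed

text \<open>Only the last corner is new, so a single expansion reduces to the determinants just
  found; the extra \<open>1\<close> in this corner makes the factor \<open>x + 1\<close> split
  off.\<close>

lemma det_tridiagonal_both:
  fixes x y :: "'a::comm_ring_1"
  assumes "x * y = 1"
  shows "x ^ Suc (Suc n) * det (tridiagonal (x + y + 1) (x + y) (x + y + 1) (Suc (Suc n)))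
    = (x + 1) * (\<Sum>i<2 * n + 4. x ^ i)"
proof -
  let ?V = "\<lambda>n. det (tridiagonal (x + y + 1) (x + y) (x + y) n)"
  define a where "a = x ^ (2 * n + 1)"
  have "x ^ Suc (Suc n) * det (tridiagonal (x + y + 1) (x + y) (x + y + 1) (Suc (Suc n)))
      = (x\<^sup>2 + x * y + x) * (x ^ Suc n * ?V (Suc n)) - x\<^sup>2 * (x ^ n * ?V n)"
    unfolding det_tridiagonal by (simp add: algebra_simps power2_eq_square)
  also have "\<dots> = (x\<^sup>2 + 1 + x) * (\<Sum>i\<le>2 * Suc n. x ^ i) - x\<^sup>2 * (\<Sum>i\<le>2 * n. x ^ i)"
    by (simp only: det_tridiagonal_left[OF assms] assms)
  also have "\<dots> = (x + 1) * ((\<Sum>i\<le>2 * n. x ^ i) + a + a * x + a * x\<^sup>2)"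
    by (simp add: a_def algebra_simps power2_eq_square)
  also have "\<dots> = (x + 1) * (\<Sum>i\<le>2 * n + 3. x ^ i)"
    by (simp add: a_def algebra_simps power2_eq_square numeral_3_eq_3)
  finally show ?thesis by (simp add: lessThan_Suc_atMost[symmetric] numeral_eq_Suc)
qed

section \<open>Evaluation of the characteristic polynomial at a Laurent polynomial\<close>

lemma comm_ring_hom_lconst: "comm_ring_hom (lconst :: 'f::field \<Rightarrow> 'f laurent)"
  by unfold_locales (auto simp: lconst_def single_add mult_single)

lemma comm_ring_hom_poly_lconst:
  "comm_ring_hom (\<lambda>p :: 'f::field poly. poly (map_poly lconst p) (y :: 'f laurent))"
proof -
  interpret c: comm_ring_hom "lconst :: 'f \<Rightarrow> 'f laurent" by (rule comm_ring_hom_lconst)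
  interpret map_poly_comm_ring_hom "lconst :: 'f \<Rightarrow> 'f laurent" ..
  show ?thesis by unfold_locales (auto simp: hom_distribs)
qed

text \<open>Evaluation at \<open>y = - x - x^(-1)\<close> is a ring homomorphism and so commutes
  with \<open>det\<close>. It turns the diagonal entries \<open>- y\<close> and \<open>1 - y\<close>
  into \<open>x + x^(-1)\<close> and \<open>x + x^(-1) + 1\<close>.\<close>

lemma charpoly_tridiag:
  assumes "l \<ge> 1"
  shows "lvar ^ (l + 1) * poly (map_poly lconst (charpoly_minus (tridiag l))) (- lvar - lvar_inv)
    = ((lvar + 1) * (\<Sum>i<2 * l + 2. lvar ^ i) :: 'f::field laurent)"
proof -
  \<comment> \<open>The size is at least 2, so the first and last corners are different
    entries.\<close>
  obtain k where k: "l = Suc k" using assms by (cases l) auto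
  let ?y = "- lvar - lvar_inv :: 'f laurent"
  interpret c: comm_ring_hom "lconst :: 'f \<Rightarrow> 'f laurent" by (rule comm_ring_hom_lconst)
  interpret ev: comm_ring_hom "\<lambda>p :: 'f poly. poly (map_poly lconst p) ?y"
    by (rule comm_ring_hom_poly_lconst)
  have inv: "lvar * lvar_inv = (1 :: 'f laurent)"
    by (simp add: lvar_def lvar_inv_def mult_single)
  let ?N = "map_mat (\<lambda>a. [:a:]) (tridiag l) - [:0, 1:] \<cdot>\<^sub>m 1\<^sub>m (dim_row (tridiag l :: 'f mat)) :: 'f poly mat"
  have "map_mat (\<lambda>p. poly (map_poly lconst p) ?y) ?N
      = tridiagonal (lvar + lvar_inv + 1) (lvar + lvar_inv) (lvar + lvar_inv + 1) (Suc (Suc k))"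
    by (rule eq_matI)
       (auto simp: tridiag_def tridiagonal_def k ev.hom_minus ev.hom_uminus map_poly_pCons c.hom_uminus)
  then have "poly (map_poly lconst (charpoly_minus (tridiag l))) ?y
      = det (tridiagonal (lvar + lvar_inv + 1) (lvar + lvar_inv) (lvar + lvar_inv + 1) (Suc (Suc k)))"
    using ev.hom_det[of ?N] by (simp add: charpoly_minus_def)
  moreover have "l + 1 = Suc (Suc k)" "2 * l + 2 = 2 * k + 4" by (simp_all add: k)
  ultimately show ?thesis
    using det_tridiagonal_both[OF inv, of k] by (simp only:)
qed

section \<open>The middle degree\<close>

interpretation fs: vector_space "fscale :: 'f::field \<Rightarrow> 'f laurent schubert_comb \<Rightarrow> 'f laurent schubert_comb"
  by unfold_locales
     (auto intro!: poly_mapping_eqI[where 'a = "nat list"] simp: fscale_def lookup_add algebra_simps lconst_def single_add mult_single)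

lemma lookup_fscale [simp]:
  "Poly_Mapping.lookup (Poly_Mapping.lookup (fscale a u) D) i = a * Poly_Mapping.lookup (Poly_Mapping.lookup u D) i"
  unfolding fscale_def lconst_def lookup_scale
  by (simp add: mult_map_scale_conv_mult[symmetric] Poly_Mapping.map.rep_eq when_def)

text \<open>With the support condition moved to coefficients, membership is a condition on single
  monomials \<open>q^i \<sigma> D\<close>.\<close>

lemma QH_deg_iff:
  "u \<in> QH_deg k n d \<longleftrightarrow> (\<forall>D i. Poly_Mapping.lookup (Poly_Mapping.lookup u D) i \<noteq> 0
     \<longrightarrow> D \<in> diagrams k n \<and> int (sum_list D) + int n * i = d)"
proof -
  have "Poly_Mapping.lookup u D \<noteq> 0 \<longleftrightarrow> (\<exists>i. Poly_Mapping.lookup (Poly_Mapping.lookup u D) i \<noteq> 0)" for D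
    by (auto simp: poly_mapping_eq_iff fun_eq_iff)
  then show ?thesis unfolding QH_deg_def QH_def by (auto simp: in_keys_iff subset_iff)
qed

lemma lookup_mid_class:
  "Poly_Mapping.lookup (Poly_Mapping.lookup (mid_class l j) D) i = (if D = [2 * l - j, j] \<and> i = 0 then 1 else 0)"
  by (auto simp: mid_class_def lookup_sigma lookup_one when_def)

lemma inj_mid_class: "inj_on (mid_class l :: nat \<Rightarrow> 'f::field laurent schubert_comb) {0..l}"
proof (rule inj_onI)
  fix i j
  assume "mid_class l i = (mid_class l j :: 'f laurent schubert_comb)"
  from arg_cong[OF this, of "\<lambda>u. Poly_Mapping.lookup (Poly_Mapping.lookup u [2 * l - i, i]) 0"]
  show "i = j" by (simp add: lookup_mid_class split: if_splits)
qed

lemma lookup_mid_sum: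
  "Poly_Mapping.lookup (Poly_Mapping.lookup (\<Sum>j\<in>{0..l}. fscale (a j) (mid_class l j)) D) i
    = (\<Sum>j\<in>{0..l}. if D = [2 * l - j, j] \<and> i = 0 then a j else 0)"
  by (simp add: lookup_sum lookup_mid_class if_distrib[of "(*) _"] cong: if_cong)

lemma mid_class_in_QH_deg:
  assumes "j \<le> l"
  shows "(mid_class l j :: 'f::field laurent schubert_comb) \<in> QH_deg 2 (2 * l + 2) (2 * int l)"
proof -
  have "Poly_Mapping.keys (mid_class l j :: 'f::field laurent schubert_comb) \<subseteq> diagrams 2 (2 * l + 2)"
    using assms by (simp add: mid_class_def diagrams_def)
  then show ?thesis
    using assms by (auto simp: QH_deg_def QH_def lookup_mid_class split: if_splits)
qed

lemma independent_mid_class: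
  "\<not> module.dependent fscale ((mid_class l :: nat \<Rightarrow> 'f::field laurent schubert_comb) ` {0..l})"
proof (rule fs.independent_if_scalars_zero)
  let ?v = "mid_class l :: nat \<Rightarrow> 'f laurent schubert_comb"
  fix f x
  assume "(\<Sum>x\<in>?v ` {0..l}. fscale (f x) x) = 0" and x: "x \<in> ?v ` {0..l}"
  then have sum: "(\<Sum>j\<in>{0..l}. fscale (f (?v j)) (?v j)) = 0"
    by (simp add: sum.reindex[OF inj_mid_class])
  obtain k where k: "k \<le> l" "x = ?v k" using x by auto
  have "(\<Sum>j\<in>{0..l}. if [2 * l - k, k] = [2 * l - j, j] \<and> (0::int) = 0 then f (?v j) else 0)
      = (\<Sum>j\<in>{0..l}. if k = j then f (?v j) else 0)"
    by (rule sum.cong) auto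
  then have "f (?v k) = 0"
    using arg_cong[OF sum, of "\<lambda>u. Poly_Mapping.lookup (Poly_Mapping.lookup u [2 * l - k, k]) 0"] k(1)
    unfolding lookup_mid_sum by simp
  then show "f x = 0" by (simp add: k)
qed simp

text \<open>Only \<open>q^0\<close> can occur: a diagram has between 0 and \<open>4 * l\<close>
  boxes, while a positive power of \<open>q\<close> would need a negative number of boxes and a
  negative power at least \<open>4 * l + 2\<close>.\<close>

lemma span_mid_class:
  "module.span fscale (mid_class l ` {0..l}) = (QH_deg 2 (2 * l + 2) (2 * int l) :: 'f::field laurent schubert_comb set)"
    (is "fs.span ?B = ?V")
proof
  have "fs.subspace ?V"
    unfolding fs.subspace_def Ball_def QH_deg_iff lookup_add lookup_fscale lookup_zero
    by (metis add_0 mult_zero_right)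
  then show "fs.span ?B \<subseteq> ?V"
    by (intro fs.span_minimal image_subsetI mid_class_in_QH_deg) simp_all
next
  show "?V \<subseteq> fs.span ?B"
  proof
    fix u :: "'f laurent schubert_comb"
    assume u: "u \<in> ?V"
    define a where "a j = Poly_Mapping.lookup (Poly_Mapping.lookup u [2 * l - j, j]) 0" for j
    have "u = (\<Sum>j\<in>{0..l}. fscale (a j) (mid_class l j))"
    proof (intro poly_mapping_eqI)
      fix D i
      show "Poly_Mapping.lookup (Poly_Mapping.lookup u D) i
        = Poly_Mapping.lookup (Poly_Mapping.lookup (\<Sum>j\<in>{0..l}. fscale (a j) (mid_class l j)) D) i"
      proof (cases "i = 0 \<and> (\<exists>k\<le>l. D = [2 * l - k, k])")
        case True
        then obtain k where k: "i = 0" "k \<le> l" "D = [2 * l - k, k]" by blast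
        have "(\<Sum>j\<in>{0..l}. if D = [2 * l - j, j] \<and> i = 0 then a j else 0)
            = (\<Sum>j\<in>{0..l}. if k = j then a j else 0)"
          using k by (intro sum.cong) auto
        then show ?thesis unfolding lookup_mid_sum using k by (simp add: a_def)
      next
        case False
        have "Poly_Mapping.lookup (Poly_Mapping.lookup u D) i = 0"
        proof (rule ccontr)
          assume nz: "Poly_Mapping.lookup (Poly_Mapping.lookup u D) i \<noteq> 0"
          then have "D \<in> diagrams 2 (2 * l + 2)" "int (sum_list D) + int (2 * l + 2) * i = 2 * int l"
            using u unfolding QH_deg_iff by blast+
          then obtain c d where D: "D = [c, d]" "d \<le> c" "c \<le> 2 * l"
            and deg: "int (c + d) + int (2 * l + 2) * i = 2 * int l"
            by (auto simp: diagrams_def length_Suc_conv numeral_2_eq_2)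
          define t where "t = int (2 * l + 2) * i"
          have t: "int (c + d) + t = 2 * int l" using deg by (simp only: t_def)
          have "int (c + d) \<le> 4 * int l" using D by simp
          have "\<not> 1 \<le> i"
          proof
            assume "1 \<le> i"
            then have "int (2 * l + 2) * 1 \<le> t" unfolding t_def by (intro mult_left_mono) auto
            then show False using t by simp
          qed
          moreover have "\<not> i \<le> - 1"
          proof
            assume "i \<le> - 1"
            then have "t \<le> int (2 * l + 2) * (- 1)" unfolding t_def by (intro mult_left_mono) auto
            then show False using t \<open>int (c + d) \<le> 4 * int l\<close> by simp
          qed
          ultimately have "i = 0" by linarith
          then have "D = [2 * l - d, d]" "d \<le> l" using deg D by auto
          then show False using False \<open>i = 0\<close> by blast
        qed
        moreover have "(\<Sum>j\<in>{0..l}. if D = [2 * l - j, j] \<and> i = 0 then a j else 0) = 0"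
          using False by (intro sum.neutral) auto
        ultimately show ?thesis unfolding lookup_mid_sum by simp
      qed
    qed
    moreover have "(\<Sum>j\<in>{0..l}. fscale (a j) (mid_class l j)) \<in> fs.span ?B"
      by (intro fs.span_sum fs.span_scale fs.span_base) auto
    ultimately show "u \<in> fs.span ?B" by simp
  qed
qed

section \<open>Multiplication by a degree zero class\<close>

text \<open>The product of the classes of \<open>[m, 0]\<close> and \<open>[1, 1]\<close> is
  \<open>q\<close>, so \<open>pieri m 2\<close> is invertible up to \<open>q\<close>, which is not a
  zero divisor.\<close>

lemma pieri_2_cancel:
  assumes "pieri m 2 u = pieri m 2 w"
    and "Poly_Mapping.keys u \<subseteq> diagrams 2 (m + 2)" "Poly_Mapping.keys w \<subseteq> diagrams 2 (m + 2)"
  shows "u = w"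
proof -
  have "schur_op m [m, 0] (pieri m 2 u) = scale q u"
    if "Poly_Mapping.keys u \<subseteq> diagrams 2 (m + 2)" for u
  proof (rule commutant_eqI[where S = "\<lambda>u. schur_op m [m, 0] (pieri m 2 u)" and T = "scale q"])
    show "commutant m (\<lambda>u. schur_op m [m, 0] (pieri m 2 u))"
      by (rule commutant_comp[OF commutant_schur_op commutant_pieri(2)])
    show "commutant m (scale q)" by (rule commutant_scale[OF commutant_id])
    have "schur_op m [m, 0] (pieri m 2 (\<sigma> [0, 0])) = pieri m 2 (schur_op m [m, 0] (\<sigma> [0, 0]))"
      by (rule commutant_commute_schur_op[OF commutant_pieri(2), symmetric])
    also have "\<dots> = scale q (\<sigma> [0, 0])"
      using schur_op_unit[of "[m, 0]" m] by (simp add: diagrams_2_iff pieri_2)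
    finally show "schur_op m [m, 0] (pieri m 2 (\<sigma> [0, 0])) = scale q (\<sigma> [0, 0])" .
  qed (rule that)
  with assms have "scale q u = scale q w" by metis
  then have "q * Poly_Mapping.lookup u D = q * Poly_Mapping.lookup w D" for D
    by (metis lookup_scale)
  then show ?thesis by (intro poly_mapping_eqI) simp
qed

text \<open>The identity \<open>\<sigma> [m, 2] = q (X_1^2 X_2^(-1) - 1)\<close> with the
  denominator cleared. At the unit both sides are \<open>q \<sigma> [2, 0]\<close>.\<close>

lemma pieri_2_schur_op:
  assumes "2 \<le> m" "Poly_Mapping.keys u \<subseteq> diagrams 2 (m + 2)"
  shows "pieri m 2 (schur_op m [m, 2] u) = scale q (pieri m (Suc 0) (pieri m (Suc 0) u) - pieri m 2 u)"
proof (rule commutant_eqI[where S = "\<lambda>u. pieri m 2 (schur_op m [m, 2] u)"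
      and T = "\<lambda>u. scale q (pieri m (Suc 0) (pieri m (Suc 0) u) - pieri m 2 u)"])
  show "commutant m (\<lambda>u. pieri m 2 (schur_op m [m, 2] u))"
    by (rule commutant_comp[OF commutant_pieri(2) commutant_schur_op])
  show "commutant m (\<lambda>u. scale q (pieri m (Suc 0) (pieri m (Suc 0) u) - pieri m 2 u))"
    by (intro commutant_scale commutant_diff commutant_pieri
        commutant_comp[OF commutant_pieri(1) commutant_pieri(1)])
  show "pieri m 2 (schur_op m [m, 2] (\<sigma> [0, 0]))
      = scale q (pieri m (Suc 0) (pieri m (Suc 0) (\<sigma> [0, 0])) - pieri m 2 (\<sigma> [0, 0]))"
    using schur_op_unit[of "[m, 2]" m] assms(1)
    by (simp add: diagrams_2_iff pieri_1 pieri_2 pieri_add numeral_2_eq_2[symmetric])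
qed (rule assms(2))

text \<open>For \<open>1 \<le> l\<close> and \<open>j \<le> l\<close>, column \<open>j\<close> of
  \<open>I - M\<close>: what \<open>A\<close> subtracts from \<open>v_j\<close>. The coefficient
  ring stays open because the class is used over both \<int>[q] and Laurent polynomials.\<close>

definition neighbours :: "nat \<Rightarrow> nat \<Rightarrow> 'r::comm_ring_1 schubert_comb" where
  "neighbours l j = (if 0 < j then \<sigma> [2 * l - (j - 1), j - 1] else 0)
     + (if 0 < j \<and> j < l then \<sigma> [2 * l - j, j] else 0)
     + (if j < l then \<sigma> [2 * l - (j + 1), j + 1] else 0)"

lemma numeral_4_6: "4 + n = Suc (Suc (Suc (Suc n)))" "6 + n = Suc (Suc (Suc (Suc (Suc (Suc n)))))"
  by simp_all

text \<open>Cancelling \<open>X_2\<close> reduces the claim to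
  \<open>X_1^2 v_j - X_2 v_j = X_2 (neighbours l j)\<close>, which the Pieri rule computes.\<close>

lemma schur_op_mid:
  assumes "1 \<le> l" "j \<le> l"
  shows "schur_op (2 * l) [2 * l, 2] (\<sigma> [2 * l - j, j]) = scale q (neighbours l j)"
proof (rule pieri_2_cancel)
  let ?m = "2 * l"
  have D: "Poly_Mapping.keys (\<sigma> [?m - j, j] :: int poly schubert_comb) \<subseteq> diagrams 2 (?m + 2)"
    using assms by (simp add: diagrams_2_iff)
  show "Poly_Mapping.keys (schur_op ?m [?m, 2] (\<sigma> [?m - j, j])) \<subseteq> diagrams 2 (?m + 2)"
    by (rule keys_schur_op[OF D])
  show "Poly_Mapping.keys (scale q (neighbours l j)) \<subseteq> diagrams 2 (?m + 2)"
    unfolding neighbours_def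
    using assms by (intro order_trans[OF keys_scale_subset] order_trans[OF Poly_Mapping.keys_add] Un_least)
      (auto simp: diagrams_2_iff)
  have "pieri ?m (Suc 0) (pieri ?m (Suc 0) (\<sigma> [?m - j, j])) - pieri ?m 2 (\<sigma> [?m - j, j])
      = pieri ?m 2 (neighbours l j)"
  proof -
    \<comment> \<open>For \<open>j \<le> 1\<close> the top row can overflow and produce
      \<open>q\<close>; for \<open>j = l\<close> the diagram is a square and the second row cannot
      grow first. Both happen at once when \<open>j = l = 1\<close>.\<close>
    consider "j = 0" | "j = 1" "l = 1" | "j = 1" "2 \<le> l" | "2 \<le> j" "j = l" | "2 \<le> j" "j < l"
      using assms by linarith
    then show ?thesis
    proof cases
      case 1
      then show ?thesis using assms
        by (simp add: neighbours_def pieri_add pieri_1 pieri_2 pieri_scale)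
    next
      case 2
      then show ?thesis
        by (simp add: neighbours_def pieri_add pieri_1 pieri_2 pieri_scale)
    next
      case 3
      then obtain k where "l = Suc (Suc k)" by (metis add_2_eq_Suc' le_add_diff_inverse2)
      with 3 show ?thesis
        by (simp add: neighbours_def pieri_add pieri_1 pieri_2 pieri_scale)
    next
      case 4
      then obtain k where "l = Suc (Suc k)" by (metis add_2_eq_Suc' le_add_diff_inverse2)
      with 4 show ?thesis
        by (simp add: neighbours_def pieri_add pieri_1 pieri_2 pieri_scale numeral_4_6)
    next
      case 5
      obtain i where "j = i + 2" using 5(1) by (metis le_add_diff_inverse2)
      moreover from this obtain k where "l = Suc (Suc (Suc (i + k)))"
        using less_imp_Suc_add[OF 5(2)] by auto
      ultimately show ?thesis
        by (simp add: neighbours_def pieri_add pieri_1 pieri_2 pieri_scale numeral_4_6)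
    qed
  qed
  then show "pieri ?m 2 (schur_op ?m [?m, 2] (\<sigma> [?m - j, j])) = pieri ?m 2 (scale q (neighbours l j))"
    using pieri_2_schur_op[OF _ D] assms by (simp add: pieri_scale)
qed

section \<open>Extension of scalars from \<int>[q] to Laurent polynomials\<close>

lemma laurent_of_zpoly_hom:
  "laurent_of_zpoly 0 = 0" "laurent_of_zpoly 1 = 1" "laurent_of_zpoly q = lvar"
  "laurent_of_zpoly (p + r) = laurent_of_zpoly p + laurent_of_zpoly r"
  "laurent_of_zpoly (p * r) = laurent_of_zpoly p * laurent_of_zpoly r"
  by (simp_all add: laurent_of_zpoly_def hom_distribs)

lemma quantum_mult_sigma:
  assumes "1 \<le> m" "D \<in> diagrams 2 (m + 2)" "E \<in> diagrams 2 (m + 2)"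
  shows "quantum_mult 2 (m + 2) (\<sigma> D) (\<sigma> E) = Poly_Mapping.map laurent_of_zpoly (schur_op m D (\<sigma> E))"
  unfolding quantum_mult_def bilinear_product_sigma_left extend_sigma quantum_table_eq[OF assms(1)]
  using assms by (simp add: schur_table_def)

lemma map_neighbours:
  "Poly_Mapping.map laurent_of_zpoly (neighbours l j) = (neighbours l j :: 'f::field laurent schubert_comb)"
  by (simp add: neighbours_def map_zero map_plus map_sigma laurent_of_zpoly_hom)

text \<open>On the middle classes, multiplication by \<open>\<sigma> [2 * l, 2]\<close> carries a
  factor \<open>q\<close>, which \<open>lvar_inv\<close> cancels.\<close>

lemma quantum_mult_mid:
  assumes "1 \<le> l" "j \<le> l"
  shows "quantum_mult 2 (2 * l + 2) (\<sigma> [0, 0] - scale lvar_inv (\<sigma> [2 * l, 2])) (mid_class l j)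
    = (mid_class l j - neighbours l j :: 'f::field laurent schubert_comb)"
proof -
  let ?v = "mid_class l j :: 'f laurent schubert_comb"
  interpret L: module_hom scale scale "\<lambda>u. quantum_mult 2 (2 * l + 2) u ?v"
    unfolding quantum_mult_def by (rule linear_op_bilinear_product)
  have dia: "[0, 0] \<in> diagrams 2 (2 * l + 2)" "[2 * l, 2] \<in> diagrams 2 (2 * l + 2)"
    "[2 * l - j, j] \<in> diagrams 2 (2 * l + 2)"
    using assms by (simp_all add: diagrams_2_iff)
  have inv: "lvar_inv * lvar = (1 :: 'f laurent)"
    by (simp add: lvar_def lvar_inv_def mult_single)
  have "quantum_mult 2 (2 * l + 2) (\<sigma> [0, 0]) ?v = ?v"
    using quantum_mult_sigma[OF _ dia(1,3), where 'a = 'f] assms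
    by (simp add: mid_class_def schur_op_def map_sigma laurent_of_zpoly_hom)
  moreover have "quantum_mult 2 (2 * l + 2) (\<sigma> [2 * l, 2]) ?v = scale lvar (neighbours l j)"
    using quantum_mult_sigma[OF _ dia(2,3), where 'a = 'f] assms
    by (simp add: mid_class_def schur_op_mid map_scale laurent_of_zpoly_hom map_neighbours)
  ultimately show ?thesis by (simp only: L.diff L.scale schubert.scale_scale inv schubert.scale_one)
qed

lemma tridiag_mid_sum:
  assumes "1 \<le> l" "j \<le> l"
  shows "(\<Sum>i\<in>{0..l}. fscale (tridiag l $$ (i, j)) (mid_class l i))
    = (mid_class l j - neighbours l j :: 'f::field laurent schubert_comb)"
proof -
  let ?v = "mid_class l :: nat \<Rightarrow> 'f laurent schubert_comb"
  \<comment> \<open>Column \<open>j\<close> is split into its diagonal entry and the entries above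
    and below. The guard \<open>0 < j\<close> is needed because \<open>j - 1\<close> is again 0 at
    \<open>j = 0\<close>.\<close>
  have "(\<Sum>i\<in>{0..l}. fscale (tridiag l $$ (i, j)) (?v i))
      = (\<Sum>i\<in>{0..l}. (if i = j then if j = 0 \<or> j = l then ?v j else 0 else 0)
          - (if 0 < j \<and> i = j - 1 then ?v (j - 1) else 0) - (if i = j + 1 then ?v (j + 1) else 0))"
  proof (rule sum.cong)
    fix i assume "i \<in> {0..l}"
    then have M: "tridiag l $$ (i, j) = (if i = j then if j = 0 \<or> j = l then 1 else 0
        else if 0 < j \<and> i = j - 1 \<or> i = j + 1 then - 1 else 0 :: 'f)"
      using assms by (auto simp: tridiag_def)
    consider "i = j" | "0 < j" "i = j - 1" | "i = j + 1"
      | "i \<noteq> j" "\<not> (0 < j \<and> i = j - 1)" "i \<noteq> j + 1" by blast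
    then show "fscale (tridiag l $$ (i, j)) (?v i)
        = (if i = j then if j = 0 \<or> j = l then ?v j else 0 else 0)
          - (if 0 < j \<and> i = j - 1 then ?v (j - 1) else 0) - (if i = j + 1 then ?v (j + 1) else 0)"
      unfolding M by cases auto
  qed simp
  also have "\<dots> = (if j = 0 \<or> j = l then ?v j else 0) - (if 0 < j then ?v (j - 1) else 0)
      - (if j < l then ?v (j + 1) else 0)"
    using assms by (cases "0 < j") (auto simp: sum_subtractf)
  also have "\<dots> = ?v j - neighbours l j"
    using assms by (auto simp: neighbours_def mid_class_def)
  finally show ?thesis .
qed

theorem theorem12:
  fixes l n :: nat
    and v :: "nat \<Rightarrow> 'f::field laurent schubert_comb"
    and M :: "'f mat"
    and \<pi> :: "'f poly"
    and x x_inv :: "'f laurent"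
  assumes "l \<ge> 1" and "n = 2 * l + 2"
    and "v = mid_class l"
    and "M = tridiag l"
    and "\<pi> = charpoly_minus M"
    and "x = lvar" and "x_inv = lvar_inv"
  shows "vector_space.dim fscale (QH_deg 2 n (2 * int l) :: 'f laurent schubert_comb set) = l + 1
    \<and> inj_on v {0..l}
    \<and> \<not> module.dependent fscale (v ` {0..l})
    \<and> module.span fscale (v ` {0..l}) = QH_deg 2 n (2 * int l)
    \<and> (\<exists>A \<in> QH_deg 2 n 0. \<forall>j\<le>l.
          quantum_mult 2 n A (v j) = (\<Sum>i\<in>{0..l}. fscale (M $$ (i, j)) (v i)))
    \<and> x ^ (l + 1) * poly (map_poly lconst \<pi>) (- x - x_inv) = (x + 1) * (\<Sum>i<n. x ^ i)"
proof (intro conjI)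
  show inj: "inj_on v {0..l}" unfolding assms by (rule inj_mid_class)
  show ind: "\<not> module.dependent fscale (v ` {0..l})" unfolding assms by (rule independent_mid_class)
  show span: "module.span fscale (v ` {0..l}) = QH_deg 2 n (2 * int l)"
    unfolding assms by (rule span_mid_class)
  have "vector_space.dim fscale (module.span fscale (v ` {0..l})) = card (v ` {0..l})"
    using ind by (rule fs.dim_span_eq_card_independent)
  then show "vector_space.dim fscale (QH_deg 2 n (2 * int l) :: 'f laurent schubert_comb set) = l + 1"
    by (simp add: span card_image[OF inj])
  show "\<exists>A \<in> QH_deg 2 n 0. \<forall>j\<le>l.
      quantum_mult 2 n A (v j) = (\<Sum>i\<in>{0..l}. fscale (M $$ (i, j)) (v i))"
  proof (intro bexI allI impI)
    \<comment> \<open>The diagram \<open>[2 * l, 2]\<close> fits because \<open>l \<ge> 1\<close>,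
      and it has \<open>2 * l + 2 = n\<close> boxes, which the degree \<open>- n\<close> of
      \<open>lvar_inv\<close> balances.\<close>
    let ?A = "\<sigma> [0, 0] - scale lvar_inv (\<sigma> [2 * l, 2]) :: 'f laurent schubert_comb"
    show "?A \<in> QH_deg 2 n 0"
      using assms(1) unfolding QH_deg_iff assms(2)
      by (auto simp: lookup_minus lookup_sigma lvar_inv_def lookup_one lookup_single when_def
          diagrams_2_iff split: if_splits)
    fix j assume "j \<le> l"
    then show "quantum_mult 2 n ?A (v j) = (\<Sum>i\<in>{0..l}. fscale (M $$ (i, j)) (v i))"
      unfolding assms quantum_mult_mid[OF assms(1) \<open>j \<le> l\<close>] tridiag_mid_sum[OF assms(1) \<open>j \<le> l\<close>] by simp
  qed
  show "x ^ (l + 1) * poly (map_poly lconst \<pi>) (- x - x_inv) = (x + 1) * (\<Sum>i<n. x ^ i)"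
    unfolding assms by (rule charpoly_tridiag[OF assms(1)])
qed

end
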